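(* For every positive integer $n \leq 3$, there does not exist $\mathcal{A} \in \mathbb{I}_n$ such that $\mathcal{A}$ is MSTD. For every integer $n \geq 4$, there exists $\mathcal{A} \in \mathbb{I}_n$ such that $\mathcal{A}$ is MSTD.
   Context: $\mathbb{I}_n$ denotes the set of all collections of $n$ disjoint (bounded, nonempty) open intervals on the real line; an element $\mathcal{A} \in \mathbb{I}_n$ is identified with the subset of $\mathbb{R}$ that is the union of its $n$ intervals. (The paper freely replaces open intervals by closed ones, as this does not affect measures.) Put $\mathcal{A} + \mathcal{A} = \{a_1 + a_2 : a_1, a_2 \in \mathcal{A}\}$ and $\mathcal{A} - \mathcal{A} = \{a_1 - a_2 : a_1, a_2 \in \mathcal{A}\}$, and let $\mu$ be Lebesgue measure on $\mathbb{R}$. $\mathcal{A}$ is called MSTD ("more sums than differences", or sum dominant) if $\mu(\mathcal{A} + \mathcal{A}) > \mu(\mathcal{A} - \mathcal{A})$. *)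

theory Defs
  imports "HOL-Analysis.Analysis" "HOL-Library.Set_Algebras"
begin

(* Disjoint open intervals may share an endpoint, as in {0<..<1} and {1<..<2}. *)
definition interval_collections :: "nat \<Rightarrow> real set set set" where
  "interval_collections n =
     {\<A>. finite \<A> \<and> card \<A> = n \<and> pairwise disjnt \<A> \<and>
          (\<forall>I\<in>\<A>. \<exists>a b. a < b \<and> I = {a<..<b})}"

(* On sets, the library's A + B is the Minkowski sum but its A - B is the relative
   complement, so the set of differences needs its own definition. *)
definition difference_set :: "real set \<Rightarrow> real set \<Rightarrow> real set" where
  "difference_set A B = {a - b | a b. a \<in> A \<and> b \<in> B}"

definition MSTD :: "real set \<Rightarrow> bool" where
  "MSTD A \<longleftrightarrow> emeasure lebesgue (A + A) > emeasure lebesgue (difference_set A A)"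

end

theory Submission
  imports Defs
begin

text \<open>The measure of a finite union of intervals, listed by increasing left endpoint, is a sum of
  terms \<^term>\<open>max 0 (r - max l R)\<close>, where R is the largest right endpoint met so far.
  For three intervals the order of the left endpoints in the sum set is known up to one
  comparison, and that of the differences up to reflecting the set, so non-existence becomes a
  linear inequality in the six endpoints. One or two intervals are three intervals with repetition.
  The set with components (0,3), (5,7), (11,12), (15,18) has a sum set of measure at least 35 and a
  difference set of measure at most 34. Removing a point from an open set
  leaves the sum set unchanged, so components can be split to increase their number.\<close>

section \<open>Measuring finite unions of intervals by a sweep from left to right\<close>

fun sweep_length :: "real \<Rightarrow> (real \<times> real) list \<Rightarrow> real" where
  "sweep_length R [] = 0"
| "sweep_length R ((l, r) # xs) = max 0 (r - max l R) + sweep_length (max R r) xs"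

definition interval_union :: "(real \<times> real) list \<Rightarrow> real set" where
  "interval_union xs = (\<Union>(l, r)\<in>set xs. {l<..<r})"

lemma interval_union_simps [simp]:
  "interval_union [] = {}"
  "interval_union ((l, r) # xs) = {l<..<r} \<union> interval_union xs"
  by (auto simp: interval_union_def)

lemma open_interval_union [simp, intro]: "open (interval_union xs)"
  by (auto simp: interval_union_def)

lemma open_lebesgue [simp]: "open A \<Longrightarrow> A \<in> sets lebesgue" for A :: "real set"
  by (simp add: borel_open sets_completionI_sets)

lemma emeasure_lebesgue_Ioo: "emeasure lebesgue {a<..<b} = ennreal (max 0 (b - a))" for a b :: real
  by (cases "a \<le> b") (auto simp: max_def)

lemma emeasure_lebesgue_Ioc: "emeasure lebesgue {a<..b} = ennreal (max 0 (b - a))" for a b :: real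
  by (cases "a \<le> b") (auto simp: max_def)

lemma sweep_length_nonneg: "0 \<le> sweep_length R xs"
  by (induction R xs rule: sweep_length.induct) auto

lemma emeasure_interval_union_le:
  assumes "sorted_wrt (\<lambda>x y. fst x \<le> fst y) xs"
  shows "emeasure lebesgue (interval_union xs \<inter> {R<..}) \<le> ennreal (sweep_length R xs)"
  using assms
proof (induction R xs rule: sweep_length.induct)
  case (2 R l r xs)
  \<comment> \<open>By sortedness every later interval starts at or after \<open>l\<close>, so its
    points beyond \<open>R\<close> either lie in \<open>{max l R<..r}\<close> or exceed
    \<open>max R r\<close>. The right end is closed because \<open>r\<close> itself may belong to a
    later interval.\<close>
  have "interval_union ((l, r) # xs) \<inter> {R<..}
      \<subseteq> {max l R<..r} \<union> (interval_union xs \<inter> {max R r<..})"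
    using 2(2) by (force simp: interval_union_def)
  then have "emeasure lebesgue (interval_union ((l, r) # xs) \<inter> {R<..})
      \<le> emeasure lebesgue ({max l R<..r} \<union> (interval_union xs \<inter> {max R r<..}))"
    by (intro emeasure_mono) auto
  also have "\<dots> \<le> emeasure lebesgue {max l R<..r} + emeasure lebesgue (interval_union xs \<inter> {max R r<..})"
    by (intro emeasure_subadditive) auto
  also have "\<dots> \<le> ennreal (max 0 (r - max l R)) + ennreal (sweep_length (max R r) xs)"
    using 2 by (intro add_mono) (auto simp: emeasure_lebesgue_Ioc)
  finally show ?case
    by (simp add: ennreal_plus[symmetric] sweep_length_nonneg del: ennreal_plus)
qed simp

text \<open>The sweep counts \<open>{max l R<..<r}\<close> and then only points beyond
  \<open>max R r\<close>; these are disjoint parts of the union for any order of the entries. This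
  covers the list of differences, where \<open>p2 - q1\<close> may be negative and yet comes after
  0.\<close>

lemma emeasure_interval_union_ge:
  "emeasure lebesgue (interval_union xs \<inter> {R<..}) \<ge> ennreal (sweep_length R xs)"
proof (induction R xs rule: sweep_length.induct)
  case (2 R l r xs)
  have "ennreal (sweep_length R ((l, r) # xs))
      = ennreal (max 0 (r - max l R)) + ennreal (sweep_length (max R r) xs)"
    by (simp add: ennreal_plus[symmetric] sweep_length_nonneg del: ennreal_plus)
  also have "\<dots> \<le> emeasure lebesgue {max l R<..<r} + emeasure lebesgue (interval_union xs \<inter> {max R r<..})"
    using 2 by (intro add_mono) (auto simp: emeasure_lebesgue_Ioo)
  also have "\<dots> = emeasure lebesgue ({max l R<..<r} \<union> (interval_union xs \<inter> {max R r<..}))"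
    by (intro plus_emeasure) auto
  also have "\<dots> \<le> emeasure lebesgue (interval_union ((l, r) # xs) \<inter> {R<..})"
    by (intro emeasure_mono) auto
  finally show ?case .
qed simp

section \<open>Openness, interval pieces and symmetry of sum and difference sets\<close>

lemma mem_difference_set: "x \<in> difference_set A B \<longleftrightarrow> (\<exists>a\<in>A. \<exists>b\<in>B. x = a - b)"
  by (auto simp: difference_set_def)

lemma open_set_plus: "open A \<or> open B \<Longrightarrow> open (A + B)" for A B :: "real set"
proof -
  have "A + B = (\<Union>x\<in>A. \<Union>y\<in>B. {x + y})"
    by (auto simp: set_plus_def)
  then show "open A \<or> open B \<Longrightarrow> open (A + B)"
    by (simp add: open_sums)
qed

lemma difference_set_eq_plus: "difference_set A B = A + uminus ` B"
  by (force simp: difference_set_def set_plus_def)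

lemma open_difference_set: "open A \<Longrightarrow> open (difference_set A B)"
  unfolding difference_set_eq_plus by (rule open_set_plus) simp

lemma difference_set_mono: "A \<subseteq> C \<Longrightarrow> B \<subseteq> D \<Longrightarrow> difference_set A B \<subseteq> difference_set C D"
  by (force simp: difference_set_def)

lemma Ioo_subset_set_plus:
  fixes a b c d :: real
  assumes "a < b" "c < d"
  shows "{a + c<..<b + d} \<subseteq> {a<..<b} + {c<..<d}"
proof
  fix x assume x: "x \<in> {a + c<..<b + d}"
  \<comment> \<open>The splitting \<open>x = t + (x - t)\<close> needs \<open>t\<close> in both
    \<open>{a<..<b}\<close> and \<open>{x - d<..<x - c}\<close>; this says that the two
    overlap.\<close>
  then have "max a (x - d) < min b (x - c)"
    using assms by auto
  then obtain t where "max a (x - d) < t" "t < min b (x - c)"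
    using dense by blast
  then have "t \<in> {a<..<b}" "x - t \<in> {c<..<d}" "x = t + (x - t)"
    by auto
  then show "x \<in> {a<..<b} + {c<..<d}"
    by (metis set_plus_intro)
qed

lemma Ioo_subset_difference_set:
  fixes a b c d :: real
  assumes "a < b" "c < d"
  shows "{a - d<..<b - c} \<subseteq> difference_set {a<..<b} {c<..<d}"
  using Ioo_subset_set_plus[of a b "-d" "-c"] assms by (simp add: difference_set_eq_plus)

lemma emeasure_lebesgue_uminus: "emeasure lebesgue (uminus ` A) = emeasure lebesgue A"
  if "open A" for A :: "real set"
  using emeasure_lebesgue_affine[of "-1" 0 A] by (simp add: image_def)

lemma difference_set_self_uminus: "uminus ` difference_set A A = difference_set A A"
  by (force simp: difference_set_def image_def)

text \<open>Negation maps the difference set to itself and exchanges its positive and negative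
  parts, so it suffices to bound the positive part from below.\<close>

lemma emeasure_difference_set_ge:
  assumes "open A"
  shows "2 * emeasure lebesgue (difference_set A A \<inter> {0<..}) \<le> emeasure lebesgue (difference_set A A)"
proof -
  let ?D = "difference_set A A"
  have op: "open ?D" using open_difference_set[OF assms] .
  have "uminus ` (?D \<inter> {0<..}) = ?D \<inter> {..<0}"
    by (subst image_Int) (auto simp: difference_set_self_uminus)
  then have "emeasure lebesgue (?D \<inter> {..<0}) = emeasure lebesgue (?D \<inter> {0<..})"
    using emeasure_lebesgue_uminus[of "?D \<inter> {0<..}"] open_Int[OF op open_greaterThan] by simp
  then have "2 * emeasure lebesgue (?D \<inter> {0<..}) = emeasure lebesgue (?D \<inter> {..<0}) + emeasure lebesgue (?D \<inter> {0<..})"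
    by (simp add: mult_2)
  also have "\<dots> = emeasure lebesgue (?D \<inter> {..<0} \<union> ?D \<inter> {0<..})"
    using op by (intro plus_emeasure) auto
  also have "\<dots> \<le> emeasure lebesgue ?D"
    using op by (intro emeasure_mono) auto
  finally show ?thesis .
qed

text \<open>Reflection negates the sum set and fixes the difference set. It serves to assume that
  the first gap between three intervals is at most the second.\<close>

lemma MSTD_uminus:
  assumes "open A" shows "MSTD (uminus ` A) \<longleftrightarrow> MSTD A"
proof -
  have "uminus ` A + uminus ` A = uminus ` (A + A)"
    by (force simp: set_plus_def image_def)
  moreover have "difference_set (uminus ` A) (uminus ` A) = difference_set A A"
    unfolding difference_set_eq_plus by (simp add: image_image add.commute)
  moreover have "open (A + A)"
    using assms by (simp add: open_set_plus)
  ultimately show ?thesis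
    by (simp add: MSTD_def emeasure_lebesgue_uminus)
qed

section \<open>Removing points and splitting components\<close>

lemma set_plus_Diff_finite:
  fixes A :: "real set"
  assumes "open A" "finite F"
  shows "(A - F) + (A - F) = A + A"
proof (intro equalityI subsetI)
  fix x assume "x \<in> A + A"
  then obtain a b where ab: "a \<in> A" "b \<in> A" "x = a + b"
    by (auto simp: set_plus_def)
  obtain d e where de: "d > 0" "ball a d \<subseteq> A" "e > 0" "ball b e \<subseteq> A"
    using assms ab by (metis openE)
  \<comment> \<open>The sum \<open>x\<close> is also \<open>(a + t) + (b - t)\<close>. All small
    positive \<open>t\<close> keep both terms in \<open>A\<close>, and only finitely many move one
    of them into \<open>F\<close>.\<close>
  have "finite ((\<lambda>y. y - a) ` F \<union> (\<lambda>y. b - y) ` F)"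
    using assms by simp
  moreover have "infinite {0<..<min d e}"
    using de by (intro infinite_Ioo) auto
  ultimately obtain t where t: "t \<in> {0<..<min d e}" "t \<notin> (\<lambda>y. y - a) ` F \<union> (\<lambda>y. b - y) ` F"
    by (meson finite_subset subsetI)
  have "a + t \<in> ball a d" "b - t \<in> ball b e"
    using t(1) by (auto simp: dist_real_def)
  moreover have "a + t \<notin> F" "b - t \<notin> F"
    using t(2) by (auto simp: image_iff)
  ultimately have "a + t \<in> A - F" "b - t \<in> A - F" "x = (a + t) + (b - t)"
    using de ab by auto
  then show "x \<in> (A - F) + (A - F)"
    by (metis set_plus_intro)
qed (auto simp: set_plus_def)

text \<open>The sum set is unchanged while the difference set can only shrink.\<close>

lemma MSTD_Diff_finite:
  assumes "open A" "finite F" "MSTD A" shows "MSTD (A - F)"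
proof -
  have "emeasure lebesgue (difference_set (A - F) (A - F)) \<le> emeasure lebesgue (difference_set A A)"
    using assms by (intro emeasure_mono difference_set_mono) (auto simp: open_difference_set)
  then show ?thesis
    using assms by (simp add: MSTD_def set_plus_Diff_finite)
qed

lemma open_Union_interval_collections: "\<A> \<in> interval_collections n \<Longrightarrow> open (\<Union>\<A>)"
  by (force simp: interval_collections_def)

text \<open>One component is cut at an interior point \<open>m\<close>. By disjointness the other
  components avoid the whole of it, so the union loses exactly \<open>m\<close>.\<close>

lemma interval_collections_Suc:
  assumes "\<A> \<in> interval_collections n" "n > 0"
  obtains \<B> x where "\<B> \<in> interval_collections (Suc n)" "\<Union>\<B> = \<Union>\<A> - {x}"
proof -
  have A: "finite \<A>" "card \<A> = n" "pairwise disjnt \<A>" "\<And>I. I \<in> \<A> \<Longrightarrow> \<exists>a b. a < b \<and> I = {a<..<b}"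
    using assms by (auto simp: interval_collections_def)
  then obtain a b where ab: "{a<..<b} \<in> \<A>" "a < b"
    using assms by (metis all_not_in_conv card.empty less_irrefl)
  obtain m where m: "a < m" "m < b"
    using dense[OF ab(2)] by blast
  define \<C> where "\<C> = \<A> - {{a<..<b}}"
  define \<B> where "\<B> = insert {a<..<m} (insert {m<..<b} \<C>)"
  have halves: "{a<..<b} - {m} = {a<..<m} \<union> {m<..<b}"
    using m by auto
  have ne: "{a<..<m} \<noteq> {}" "{m<..<b} \<noteq> {}" "{a<..<m} \<inter> {m<..<b} = {}"
    using m by auto
  have C: "disjnt {a<..<b} I" if "I \<in> \<C>" for I
    using that A(3) ab(1) by (auto simp: \<C>_def pairwise_def)
  have C1: "{a<..<m} \<inter> I = {}" "{m<..<b} \<inter> I = {}" "m \<notin> I" if "I \<in> \<C>" for I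
    using C[OF that] halves m unfolding disjnt_iff by auto
  \<comment> \<open>Both halves are nonempty and disjoint from each other and from the rest, hence
    they are two new members and the cardinality grows by exactly one.\<close>
  have "{a<..<m} \<notin> \<C>" "{m<..<b} \<notin> \<C>" "{a<..<m} \<noteq> {m<..<b}"
    using C1 ne by blast+
  moreover have "card \<C> = n - 1" "finite \<C>"
    using A ab by (auto simp: \<C>_def)
  ultimately have "finite \<B>" "card \<B> = Suc n"
    using assms(2) by (auto simp: \<B>_def)
  moreover have "pairwise disjnt \<C>"
    using A(3) by (rule pairwise_subset) (auto simp: \<C>_def)
  then have "pairwise disjnt \<B>"
    unfolding \<B>_def pairwise_insert using C1 ne by (auto simp: disjnt_def)
  moreover have "\<exists>a b. a < b \<and> I = {a<..<b}" if "I \<in> \<B>" for I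
    using that A(4) m by (auto simp: \<B>_def \<C>_def)
  ultimately have "\<B> \<in> interval_collections (Suc n)"
    by (auto simp: interval_collections_def)
  moreover have "\<Union>\<A> = {a<..<b} \<union> \<Union>\<C>"
    using ab(1) by (auto simp: \<C>_def)
  then have "\<Union>\<B> = \<Union>\<A> - {m}"
    using halves C1(3) unfolding \<B>_def by auto
  ultimately show thesis by (rule that)
qed

section \<open>At most three intervals\<close>

lemma sweep_length_sums_le_if_middle_first:
  fixes p1 p2 p3 q1 q2 q3 m :: real
  assumes "p1 < q1" "p2 < q2" "p3 < q3" "p1 \<le> p2" "p2 \<le> p3" "q1 \<le> q2" "q2 \<le> q3"
    and "p2 - q1 \<le> p3 - q2" "m \<ge> q1 - p1" "m \<ge> q2 - p2" "m \<ge> q3 - p3"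
    "m = q1 - p1 \<or> m = q2 - p2 \<or> m = q3 - p3" "2 * p2 \<le> p1 + p3"
  shows "sweep_length (2*p1)
      [(2*p1, 2*q1), (p1+p2, q1+q2), (2*p2, 2*q2), (p1+p3, q1+q3), (p2+p3, q2+q3), (2*p3, 2*q3)]
    \<le> 2 * sweep_length 0 [(0, m), (p2-q1, q2-p1), (p3-q2, q3-p2), (p3-q1, q3-p1)]"
  \<comment> \<open>The left list holds the six pairwise sums by left endpoint. In the right list
    \<open>m\<close> is the largest length, so \<open>(0, m)\<close> stands for the positive
    differences within single intervals; the other entries are later minus earlier intervals.
    Unfolding leaves a piecewise linear inequality, settled by splitting the \<open>max\<close>
    terms.\<close>
  using assms by simp (smt (verit))

text \<open>Comparing \<open>2 * p2\<close> with \<open>p1 + p3\<close> is the only question about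
  left endpoints of sums that \<open>p1 \<le> p2 \<le> p3\<close> leaves open; here the third and
  fourth entries change places.\<close>

lemma sweep_length_sums_le_if_outer_first:
  fixes p1 p2 p3 q1 q2 q3 m :: real
  assumes "p1 < q1" "p2 < q2" "p3 < q3" "p1 \<le> p2" "p2 \<le> p3" "q1 \<le> q2" "q2 \<le> q3"
    and "p2 - q1 \<le> p3 - q2" "m \<ge> q1 - p1" "m \<ge> q2 - p2" "m \<ge> q3 - p3"
    "m = q1 - p1 \<or> m = q2 - p2 \<or> m = q3 - p3" "p1 + p3 \<le> 2 * p2"
  shows "sweep_length (2*p1)
      [(2*p1, 2*q1), (p1+p2, q1+q2), (p1+p3, q1+q3), (2*p2, 2*q2), (p2+p3, q2+q3), (2*p3, 2*q3)]
    \<le> 2 * sweep_length 0 [(0, m), (p2-q1, q2-p1), (p3-q2, q3-p2), (p3-q1, q3-p1)]"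
  using assms by simp (smt (verit))

text \<open>The sweep bounds the sum set from above and the positive half of the difference set from
  below. The weak inequalities between endpoints admit repeated intervals, for which the gaps
  \<open>p2 - q1\<close> or \<open>p3 - q2\<close> are negative.\<close>

lemma sorted_intervals_not_MSTD_if_gaps_le:
  fixes p1 p2 p3 q1 q2 q3 :: real
  assumes I: "p1 < q1" "p2 < q2" "p3 < q3" "p1 \<le> p2" "p2 \<le> p3" "q1 \<le> q2" "q2 \<le> q3"
    and gap: "p2 - q1 \<le> p3 - q2"
  shows "\<not> MSTD ({p1<..<q1} \<union> {p2<..<q2} \<union> {p3<..<q3})" (is "\<not> MSTD ?A")
proof -
  define m where "m = Max {q1 - p1, q2 - p2, q3 - p3}"
  have m: "m \<ge> q1 - p1" "m \<ge> q2 - p2" "m \<ge> q3 - p3"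
    "m = q1 - p1 \<or> m = q2 - p2 \<or> m = q3 - p3"
    by (auto simp: m_def max_def)
  define ds where "ds = [(0, m), (p2-q1, q2-p1), (p3-q2, q3-p2), (p3-q1, q3-p1)]"
  obtain ss where ss:
    "set ss = {(2*p1, 2*q1), (p1+p2, q1+q2), (2*p2, 2*q2), (p1+p3, q1+q3), (p2+p3, q2+q3), (2*p3, 2*q3)}"
    "sorted_wrt (\<lambda>x y. fst x \<le> fst y) ss" "sweep_length (2*p1) ss \<le> 2 * sweep_length 0 ds"
  proof (cases "2 * p2 \<le> p1 + p3")
    case True
    show ?thesis
      by (rule that[OF _ _ sweep_length_sums_le_if_middle_first
            [OF I gap m True, folded ds_def]]) (use I True in auto)
  next
    case False
    then have le: "p1 + p3 \<le> 2 * p2" by simp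
    show ?thesis
      by (rule that[OF _ _ sweep_length_sums_le_if_outer_first
            [OF I gap m le, folded ds_def]]) (use I le in auto)
  qed
  \<comment> \<open>All sums exceed \<open>2*p1\<close>, so a sweep starting there misses
    nothing.\<close>
  have "?A + ?A \<subseteq> interval_union ss \<inter> {2*p1<..}"
    using I by (auto simp: interval_union_def ss(1) set_plus_def)
  then have "emeasure lebesgue (?A + ?A) \<le> emeasure lebesgue (interval_union ss \<inter> {2*p1<..})"
    by (intro emeasure_mono) auto
  also have "\<dots> \<le> ennreal (sweep_length (2*p1) ss)"
    by (rule emeasure_interval_union_le[OF ss(2)])
  also have "\<dots> \<le> 2 * ennreal (sweep_length 0 ds)"
    using ss(3) by (simp add: ennreal_mult'[symmetric] ennreal_leI flip: ennreal_numeral)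
  also have "\<dots> \<le> 2 * emeasure lebesgue (interval_union ds \<inter> {0<..})"
    by (intro mult_left_mono emeasure_interval_union_ge) auto
  also have "\<dots> \<le> 2 * emeasure lebesgue (difference_set ?A ?A \<inter> {0<..})"
  proof (intro mult_left_mono emeasure_mono Int_mono order_refl)
    have D: "{a - d<..<b - c} \<subseteq> difference_set ?A ?A"
      if "a < b" "c < d" "{a<..<b} \<subseteq> ?A" "{c<..<d} \<subseteq> ?A" for a b c d
      using Ioo_subset_difference_set[OF that(1,2)] difference_set_mono[OF that(3,4)] by blast
    have sub: "{p1<..<q1} \<subseteq> ?A" "{p2<..<q2} \<subseteq> ?A" "{p3<..<q3} \<subseteq> ?A"
      by auto
    \<comment> \<open>The maximum \<open>m\<close> is attained by one of the intervals, whose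
      differences with itself fill \<open>{-m<..<m}\<close>.\<close>
    obtain p q where pq: "p < q" "{p<..<q} \<subseteq> ?A" "m = q - p"
      using m(4) I(1-3) sub by blast
    have "{0<..<m} \<subseteq> {p - q<..<q - p}"
      using pq(1,3) by auto
    also have "\<dots> \<subseteq> difference_set ?A ?A"
      by (rule D[OF pq(1,1,2,2)])
    finally have "{0<..<m} \<subseteq> difference_set ?A ?A" .
    moreover note D[OF I(2,1) sub(2,1)] D[OF I(3,2) sub(3,2)] D[OF I(3,1) sub(3,1)]
    ultimately show "interval_union ds \<subseteq> difference_set ?A ?A"
      by (simp add: ds_def)
  qed (simp_all add: open_difference_set open_Un open_Int)
  also have "\<dots> \<le> emeasure lebesgue (difference_set ?A ?A)"
    by (rule emeasure_difference_set_ge) (intro open_Un open_greaterThanLessThan)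
  finally show ?thesis
    by (simp add: MSTD_def not_less)
qed

lemma sorted_intervals_not_MSTD:
  fixes p1 p2 p3 q1 q2 q3 :: real
  assumes I: "p1 < q1" "p2 < q2" "p3 < q3" "p1 \<le> p2" "p2 \<le> p3" "q1 \<le> q2" "q2 \<le> q3"
  shows "\<not> MSTD ({p1<..<q1} \<union> {p2<..<q2} \<union> {p3<..<q3})"
proof (cases "p2 - q1 \<le> p3 - q2")
  case True
  then show ?thesis using I by (intro sorted_intervals_not_MSTD_if_gaps_le)
next
  case False
  \<comment> \<open>Reflection reverses the order of the intervals and so exchanges the two
    gaps.\<close>
  have "\<not> MSTD ({-q3<..<-p3} \<union> {-q2<..<-p2} \<union> {-q1<..<-p1})"
    using I False by (intro sorted_intervals_not_MSTD_if_gaps_le) auto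
  also have "{-q3<..<-p3} \<union> {-q2<..<-p2} \<union> {-q1<..<-p1}
      = uminus ` ({p1<..<q1} \<union> {p2<..<q2} \<union> {p3<..<q3})"
    by (simp add: image_Un Un_ac)
  finally show ?thesis
    using MSTD_uminus[of "{p1<..<q1} \<union> {p2<..<q2} \<union> {p3<..<q3}"] by (simp add: open_Un)
qed

lemma interval_collections_le_3_not_MSTD:
  assumes "\<A> \<in> interval_collections n" "1 \<le> n" "n \<le> 3"
  shows "\<not> MSTD (\<Union>\<A>)"
proof -
  have A: "card \<A> = n" "pairwise disjnt \<A>" "\<And>I. I \<in> \<A> \<Longrightarrow> \<exists>a b. a < b \<and> I = {a<..<b}"
    using assms by (auto simp: interval_collections_def)
  have ends: "Inf I < Sup I" "I = {Inf I<..<Sup I}" if "I \<in> \<A>" for I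
    using A(3)[OF that] by auto
  \<comment> \<open>Disjoint intervals are ordered by both endpoints at once: otherwise a point
    between the larger \<open>Inf\<close> and the smaller \<open>Sup\<close> would lie in both.
    Equal intervals are comparable too, which permits repetition.\<close>
  define le where "le I J \<longleftrightarrow> Inf I \<le> Inf J \<and> Sup I \<le> Sup J" for I J :: "real set"
  have total: "le I J \<or> le J I" if "I \<in> \<A>" "J \<in> \<A>" for I J
  proof (cases "I = J")
    case False
    then have "I \<inter> J = {}"
      using A(2) that by (auto simp: pairwise_def disjnt_def)
    then have "Sup I \<le> Inf J \<or> Sup J \<le> Inf I"
      using ends[OF that(1)] ends[OF that(2)] dense[of "max (Inf I) (Inf J)" "min (Sup I) (Sup J)"]
      by (metis IntI empty_iff greaterThanLessThan_iff linorder_not_le max_less_iff_conj min_less_iff_conj)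
    then show ?thesis
      using ends(1)[OF that(1)] ends(1)[OF that(2)] by (auto simp: le_def)
  qed (auto simp: le_def)
  have "n = 1 \<or> n = 2 \<or> n = 3"
    using assms by auto
  then obtain I J K where IJK: "\<A> = {I, J, K}"
    using A(1) by (metis card_1_singletonE card_2_iff card_3_iff insert_absorb2)
  \<comment> \<open>For a total relation, one of the orders of three elements is always a chain of
    two consecutive comparisons.\<close>
  have "\<exists>I J K. \<A> = {I, J, K} \<and> le I J \<and> le J K"
  proof -
    have "{J,I,K} = {I,J,K}" "{I,K,J} = {I,J,K}" "{K,I,J} = {I,J,K}" "{J,K,I} = {I,J,K}" "{K,J,I} = {I,J,K}"
      by auto
    moreover have "le I J \<or> le J I" "le I K \<or> le K I" "le J K \<or> le K J"
      using total IJK by auto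
    ultimately show ?thesis
      unfolding IJK by metis
  qed
  then obtain I J K where IJK: "\<A> = {I, J, K}" and le: "le I J" "le J K"
    by blast
  have "\<not> MSTD ({Inf I<..<Sup I} \<union> {Inf J<..<Sup J} \<union> {Inf K<..<Sup K})"
    using le ends(1) by (intro sorted_intervals_not_MSTD) (auto simp: IJK le_def)
  moreover have "\<Union>\<A> = I \<union> J \<union> K"
    by (auto simp: IJK)
  ultimately show ?thesis
    using ends(2) by (simp add: IJK)
qed

section \<open>Four or more intervals\<close>

lemma interval_collections_4_MSTD: "\<exists>\<A>\<in>interval_collections 4. MSTD (\<Union>\<A>)"
proof
  \<comment> \<open>Up to finitely many points the sum set misses only \<open>{25..26}\<close> from
    \<open>{0<..<36}\<close>, whereas the difference set misses both \<open>{7..8}\<close> and its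
    mirror image from \<open>{-18<..<18}\<close>. This gives 35 against 34.\<close>
  let ?\<A> = "{{0<..<3}, {5<..<7}, {11<..<12}, {15<..<18}} :: real set set"
  let ?A = "\<Union>?\<A>"
  have ne: "I \<noteq> J" if "disjnt I J" "I \<noteq> {}" for I J :: "real set"
    using that by (auto simp: disjnt_def)
  have disj: "disjnt {a<..<b} {c<..<d}" if "b \<le> c" for a b c d :: real
    using that by (auto simp: disjnt_def)
  have "card ?\<A> = 4"
    by (simp add: ne disj)
  moreover have "pairwise disjnt ?\<A>"
    by (auto simp: pairwise_insert disjnt_def)
  moreover have "\<forall>I\<in>?\<A>. \<exists>a b. a < b \<and> I = {a<..<b}"
  proof -
    have "\<exists>a b. a < b \<and> {c<..<d} = {a<..<b}" if "c < d" for c d :: real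
      using that by blast
    then show ?thesis by simp
  qed
  ultimately show "?\<A> \<in> interval_collections 4"
    by (simp add: interval_collections_def)
  \<comment> \<open>The endpoints are left unevaluated so that each entry unifies with a sum of two components.\<close>
  define ss :: "(real \<times> real) list" where
    "ss = [(0+0,3+3), (0+5,3+7), (5+5,7+7), (0+11,3+12), (0+15,3+18), (5+15,7+18), (11+15,12+18), (15+15,18+18)]"
  define ds :: "(real \<times> real) list" where
    "ds = [(-18,-8), (-7,7), (8,18)]"
  have "difference_set ?A ?A \<subseteq> interval_union ds \<inter> {-18<..}"
    by (auto simp: mem_difference_set ds_def)
  then have "emeasure lebesgue (difference_set ?A ?A) \<le> emeasure lebesgue (interval_union ds \<inter> {-18<..})"
    by (intro emeasure_mono) auto
  also have "\<dots> \<le> ennreal (sweep_length (-18) ds)"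
    by (intro emeasure_interval_union_le) (auto simp: ds_def)
  also have "sweep_length (-18) ds = 34"
    by (simp add: ds_def)
  also have "ennreal 34 < ennreal 35"
    by (simp add: ennreal_less_iff)
  also have "35 = sweep_length 0 ss"
    by (simp add: ss_def)
  \<comment> \<open>Eight of the ten pairwise sums are listed; the other two, (16,19) and (22,24),
    lie inside (15,21) and (20,25).\<close>
  also have "ennreal (sweep_length 0 ss) \<le> emeasure lebesgue (interval_union ss \<inter> {0<..})"
    by (rule emeasure_interval_union_ge)
  also have "\<dots> \<le> emeasure lebesgue (?A + ?A)"
  proof (intro emeasure_mono)
    have S: "{a + c<..<b + d} \<subseteq> ?A + ?A"
      if "a < b" "c < d" "{a<..<b} \<subseteq> ?A" "{c<..<d} \<subseteq> ?A" for a b c d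
      using Ioo_subset_set_plus[OF that(1,2)] set_plus_mono2[OF that(3,4)] by blast
    have "interval_union ss \<subseteq> ?A + ?A"
      unfolding ss_def interval_union_simps by (intro Un_least S empty_subsetI) auto
    then show "interval_union ss \<inter> {0<..} \<subseteq> ?A + ?A"
      by blast
  qed (simp add: open_set_plus open_Un)
  finally show "MSTD ?A"
    by (simp add: MSTD_def)
qed

lemma interval_collections_ge_4_MSTD:
  assumes "n \<ge> 4"
  shows "\<exists>\<A>\<in>interval_collections n. MSTD (\<Union>\<A>)"
  using assms
proof (induction n rule: dec_induct)
  case base
  show ?case by (rule interval_collections_4_MSTD)
next
  case (step n)
  then obtain \<A> where \<A>: "\<A> \<in> interval_collections n" "MSTD (\<Union>\<A>)"
    by blast
  obtain \<B> x where "\<B> \<in> interval_collections (Suc n)" "\<Union>\<B> = \<Union>\<A> - {x}"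
    using interval_collections_Suc[OF \<A>(1)] step.hyps by auto
  moreover have "MSTD (\<Union>\<A> - {x})"
    using \<A> by (intro MSTD_Diff_finite open_Union_interval_collections) auto
  ultimately show ?case by metis
qed

theorem theorem1p2:
  shows "(\<forall>n::nat. 1 \<le> n \<and> n \<le> 3 \<longrightarrow> \<not> (\<exists>\<A>\<in>interval_collections n. MSTD (\<Union>\<A>))) \<and>
         (\<forall>n::nat. n \<ge> 4 \<longrightarrow> (\<exists>\<A>\<in>interval_collections n. MSTD (\<Union>\<A>)))"
  using interval_collections_le_3_not_MSTD interval_collections_ge_4_MSTD by blast

end
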